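(* Let $A,B,F,E,C,D,G,\gamma$ be the data of the uncertain system described in the context, on the interval $[t_0,t_f]$, with $\gamma(t)>0$ for all $t$. Suppose that there exist a continuously differentiable $Q:[t_{0},t_{f}]\to\mathbb{S}_{++}^{n_{x}}$, functions $Y:[t_{0},t_{f}]\to\mathbb{R}^{n_{u}\times n_{x}}$ and $\nu:[t_{0},t_{f}]\to\mathbb{R}_{++}$, and constants $\lambda_{w}>0$ and $\alpha>0$ such that for all $t\in[t_{0},t_{f}]$ $$ \begin{bmatrix} M-\dot{Q} & \nu E & F & (CQ+DY)^{\top}\\ \nu E^{\top} & -\nu I & 0 & 0\\ F^{\top} & 0 & -\lambda_{w}I & G^{\top}\\ CQ+DY & 0 & G & -\nu\frac{1}{\gamma^{2}}I \end{bmatrix}\preceq 0, \qquad M := QA^{\top}+Y^{\top}B^{\top}+AQ+BY+\alpha Q+\lambda_{w}Q, $$ where the time argument $t$ is omitted. Let $K(t)=Y(t)Q(t)^{-1}$ and $V(t,\eta)=\eta^{\top}Q(t)^{-1}\eta$. Then the Lyapunov condition (defined in the context) holds with this $Q$, $K$, $\alpha$ for the closed-loop system with feedback gain $K$. Consequently: (i) the time-varying ellipsoid $\mathcal{E}(t)=\{\eta\in\mathbb{R}^{n_x} : \eta^{\top}Q(t)^{-1}\eta\leq 1\}$ is invariant for the closed-loop system, i.e. every solution $\eta(\cdot)$ with $\eta(t_0)\in\mathcal{E}(t_0)$ satisfies $\eta(t)\in\mathcal{E}(t)$ for all $t\in[t_0,t_f]$; (ii) $\mathcal{E}(t)$ is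 attractive, i.e. every solution $\eta(\cdot)$ of the closed-loop system satisfies $V(t,\eta(t))\leq\max\{e^{-\alpha(t-t_{0})}V(t_{0},\eta(t_{0})),\,1\}$ for all $t\in[t_0,t_f]$; (iii) for every continuous function $c:[t_0,t_f]\to(0,1]$ satisfying $\frac{1}{c(t)}\geq\max\{1,\,e^{-\alpha(t-t_{0})}\frac{1}{c(t_{0})}\}$ for all $t\in[t_0,t_f]$, the ellipsoid $\mathcal{E}_{c}(t)=\{\eta\in\mathbb{R}^{n_x} : \eta^{\top}Q(t)^{-1}\eta\leq \frac{1}{c(t)}\}$ is invariant for the closed-loop system, i.e. every solution $\eta(\cdot)$ with $\eta(t_0)\in\mathcal{E}_c(t_0)$ satisfies $\eta(t)\in\mathcal{E}_c(t)$ for all $t\in[t_0,t_f]$.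
   Context: Notation: $\mathbb{R}_{+}$ and $\mathbb{R}_{++}$ are the nonnegative and positive reals; $\mathbb{S}^{n}_{++}$ is the set of symmetric positive definite $n\times n$ real matrices; $X\preceq 0$ means that the symmetric matrix $X$ is negative semidefinite. Setting: Let $t_0<t_f$ with $t_0\ge 0$. Let $f:\mathbb{R}_+\times\mathbb{R}^{n_x}\times\mathbb{R}^{n_u}\times\mathbb{R}^{n_w}\to\mathbb{R}^{n_x}$ be continuously differentiable, and let $(\bar x(\cdot),\bar u(\cdot),0)$ be a nominal trajectory of $\dot x=f(t,x,u,w)$ on $[t_0,t_f]$ (with zero disturbance). $A(t)\in\mathbb{R}^{n_x\times n_x}$, $B(t)\in\mathbb{R}^{n_x\times n_u}$, $F(t)\in\mathbb{R}^{n_x\times n_w}$ are the partial Jacobians of $f$ with respect to $x,u,w$ along the nominal trajectory; $E\in\mathbb{R}^{n_x\times n_p}$, $C\in\mathbb{R}^{n_q\times n_x}$, $D\in\mathbb{R}^{n_q\times n_u}$, $G\in\mathbb{R}^{n_q\times n_w}$ are constant matrices; $\gamma:[t_0,t_f]\to\mathbb{R}_+$ is a (local Lipschitz constant) function. The results concern only the following uncertain system for the deviation $\eta=x-\bar x$. Closed-loop system with feedback gain $K:[t_0,t_f]\to\mathbb{R}^{n_u\times n_x}$: $$\dot\eta=(A+BK)\eta+Fw+E\,\delta p,\qquad \sup_{t\in[t_0,t_f]}\|w(t)\|_2\le 1,$$ $$\delta q=C\eta+D\xi+Gw,\quad \xi=K\eta,\qquad \|\delta p(t)\|_2\le\gamma(t)\|\delta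 q(t)\|_2,$$ with $\eta(t)\in\mathbb{R}^{n_x}$, $w(t)\in\mathbb{R}^{n_w}$, $\delta p(t)\in\mathbb{R}^{n_p}$, $\delta q(t)\in\mathbb{R}^{n_q}$. A solution is an absolutely continuous $\eta:[t_0,t_f]\to\mathbb{R}^{n_x}$ for which there exist functions $w:[t_0,t_f]\to\mathbb{R}^{n_w}$ and $\delta p:[t_0,t_f]\to\mathbb{R}^{n_p}$ such that $\sup_{t\in[t_0,t_f]}\|w(t)\|_2\le 1$, $\|\delta p(t)\|_2\le\gamma(t)\|\delta q(t)\|_2$ for all $t\in[t_0,t_f]$ with $\delta q=C\eta+D\xi+Gw$ and $\xi=K\eta$, and $\dot\eta=(A+BK)\eta+Fw+E\,\delta p$ almost everywhere on $[t_0,t_f]$. Lyapunov condition for $Q$ (continuously differentiable, positive definite valued), $K$ and decay rate $\alpha>0$: with $V(t,\eta)=\eta^\top Q(t)^{-1}\eta$, for all $t\in[t_0,t_f]$ and all $\eta\in\mathbb{R}^{n_x}$, $w\in\mathbb{R}^{n_w}$, $\delta p\in\mathbb{R}^{n_p}$ such that $\|\delta p\|_2\le\gamma(t)\|\delta q\|_2$ (where $\delta q=(C+DK(t))\eta+Gw$) and $V(t,\eta)\ge\|w\|_2^2$, one has $\dot V(t,\eta)\le-\alpha V(t,\eta)$, where $$\dot V(t,\eta)=2\eta^\top Q^{-1}\big((A+BK)\eta+Fw+E\delta p\big)-\eta^\top Q^{-1}\dot Q Q^{-1}\eta$$ is the derivative of $V$ along the closed-loop dynamics. *)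

theory Defs
  imports "HOL-Analysis.Analysis"
begin

text \<open>An \<open>m\<close>-by-\<open>n\<close> matrix has type \<open>real ^ 'n ^ 'm\<close>. Functions on \<open>[t0, tf]\<close> are total functions on
  \<^typ>\<open>real\<close> of which only the values on \<^term>\<open>{t0..tf}\<close> matter; derivatives are
  accordingly taken within \<^term>\<open>{t0..tf}\<close> (one-sided at the end points).\<close>

definition pos_def_matrix :: "real ^ 'n ^ 'n \<Rightarrow> bool" where
  "pos_def_matrix X \<longleftrightarrow> transpose X = X \<and> (\<forall>v. v \<noteq> 0 \<longrightarrow> 0 < v \<bullet> (X *v v))"

definition neg_semidef_matrix :: "real ^ 'n ^ 'n \<Rightarrow> bool" where
  "neg_semidef_matrix X \<longleftrightarrow> transpose X = X \<and> (\<forall>v. v \<bullet> (X *v v) \<le> 0)"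

text \<open>Block matrices: \<open>P ||| R\<close> puts \<open>R\<close> to the right of \<open>P\<close>, \<open>P /// R\<close> puts \<open>R\<close> below \<open>P\<close>.\<close>

definition hblock :: "real ^ 'a ^ 'm \<Rightarrow> real ^ 'b ^ 'm \<Rightarrow> real ^ ('a + 'b) ^ 'm"  (infixr "|||" 61) where
  "P ||| R = (\<chi> i j. case j of Inl a \<Rightarrow> P $ i $ a | Inr b \<Rightarrow> R $ i $ b)"

definition vblock :: "real ^ 'n ^ 'a \<Rightarrow> real ^ 'n ^ 'b \<Rightarrow> real ^ 'n ^ ('a + 'b)"  (infixr "'/'/'/" 60) where
  "P /// R = (\<chi> i. case i of Inl a \<Rightarrow> P $ a | Inr b \<Rightarrow> R $ b)"

text \<open>Unlike \<^const>\<open>C1_differentiable_on\<close>, this uses derivatives within \<open>S\<close>, so it is meaningful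
  at boundary points. It is applied only to sets on which such derivatives are unique.\<close>

definition cont_differentiable_on ::
    "('a::real_normed_vector \<Rightarrow> 'b::real_normed_vector) \<Rightarrow> 'a set \<Rightarrow> bool" where
  "cont_differentiable_on f S \<longleftrightarrow>
     (\<exists>f'. (\<forall>z\<in>S. (f has_derivative blinfun_apply (f' z)) (at z within S)) \<and> continuous_on S f')"

text \<open>Absolute continuity of a function (the library constant \<^const>\<open>absolutely_continuous\<close>
  concerns measures): the members of a division are compact intervals with disjoint interiors.\<close>

definition abs_continuous_on :: "(real \<Rightarrow> 'a::real_normed_vector) \<Rightarrow> real set \<Rightarrow> bool" where
  "abs_continuous_on f S \<longleftrightarrow>
     (\<forall>\<epsilon>>0. \<exists>\<delta>>0. \<forall>D. D division_of \<Union>D \<and> \<Union>D \<subseteq> S \<and> (\<Sum>k\<in>D. Sup k - Inf k) < \<delta>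
        \<longrightarrow> (\<Sum>k\<in>D. norm (f (Sup k) - f (Inf k))) < \<epsilon>)"

definition ode_trajectory ::
    "(real \<times> (real ^ 'x) \<times> (real ^ 'u) \<times> (real ^ 'w) \<Rightarrow> real ^ 'x) \<Rightarrow> real \<Rightarrow> real
      \<Rightarrow> (real \<Rightarrow> real ^ 'x) \<Rightarrow> (real \<Rightarrow> real ^ 'u) \<Rightarrow> (real \<Rightarrow> real ^ 'w) \<Rightarrow> bool" where
  "ode_trajectory f t0 tf x u w \<longleftrightarrow>
     abs_continuous_on x {t0..tf} \<and>
     (AE t in lebesgue_on {t0..tf}.
        (x has_vector_derivative f (t, x t, u t, w t)) (at t within {t0..tf}))"

definition closed_loop_solution ::
    "real \<Rightarrow> real \<Rightarrow> (real \<Rightarrow> real ^ 'x ^ 'x) \<Rightarrow> (real \<Rightarrow> real ^ 'u ^ 'x) \<Rightarrow> (real \<Rightarrow> real ^ 'w ^ 'x)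
      \<Rightarrow> real ^ 'p ^ 'x \<Rightarrow> real ^ 'x ^ 'q \<Rightarrow> real ^ 'u ^ 'q \<Rightarrow> real ^ 'w ^ 'q
      \<Rightarrow> (real \<Rightarrow> real) \<Rightarrow> (real \<Rightarrow> real ^ 'x ^ 'u) \<Rightarrow> (real \<Rightarrow> real ^ 'x) \<Rightarrow> bool" where
  "closed_loop_solution t0 tf A B F E C D G \<gamma> K \<eta> \<longleftrightarrow>
     abs_continuous_on \<eta> {t0..tf} \<and>
     (\<exists>w \<delta>p.
        (SUP t\<in>{t0..tf}. ereal (norm (w t))) \<le> 1 \<and>
        (\<forall>t\<in>{t0..tf}. let \<xi> = K t *v \<eta> t; \<delta>q = C *v \<eta> t + D *v \<xi> + G *v w t
           in norm (\<delta>p t) \<le> \<gamma> t * norm \<delta>q) \<and>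
        (AE t in lebesgue_on {t0..tf}.
           (\<eta> has_vector_derivative (A t + B t ** K t) *v \<eta> t + F t *v w t + E *v \<delta>p t)
             (at t within {t0..tf})))"

definition lyap_fun :: "(real \<Rightarrow> real ^ 'x ^ 'x) \<Rightarrow> real \<Rightarrow> real ^ 'x \<Rightarrow> real" where
  "lyap_fun Q t \<eta> = \<eta> \<bullet> (matrix_inv (Q t) *v \<eta>)"

text \<open>Here \<open>Q'\<close> is the time derivative of \<open>Q\<close>, and \<open>Vdot\<close> is the derivative of
  \<^term>\<open>\<lambda>t. lyap_fun Q t (\<eta> t)\<close> along the closed-loop dynamics.\<close>

definition lyapunov_condition ::
    "real \<Rightarrow> real \<Rightarrow> (real \<Rightarrow> real ^ 'x ^ 'x) \<Rightarrow> (real \<Rightarrow> real ^ 'u ^ 'x) \<Rightarrow> (real \<Rightarrow> real ^ 'w ^ 'x)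
      \<Rightarrow> real ^ 'p ^ 'x \<Rightarrow> real ^ 'x ^ 'q \<Rightarrow> real ^ 'u ^ 'q \<Rightarrow> real ^ 'w ^ 'q
      \<Rightarrow> (real \<Rightarrow> real) \<Rightarrow> (real \<Rightarrow> real ^ 'x ^ 'x) \<Rightarrow> (real \<Rightarrow> real ^ 'x ^ 'u) \<Rightarrow> real \<Rightarrow> bool" where
  "lyapunov_condition t0 tf A B F E C D G \<gamma> Q K \<alpha> \<longleftrightarrow>
     (\<forall>t\<in>{t0..tf}. \<forall>(\<eta> :: real ^ 'x) (w :: real ^ 'w) (\<delta>p :: real ^ 'p).
        let \<delta>q = (C + D ** K t) *v \<eta> + G *v w;
            Qi = matrix_inv (Q t);
            Q' = vector_derivative Q (at t within {t0..tf});
            Vdot = 2 * (\<eta> \<bullet> (Qi *v ((A t + B t ** K t) *v \<eta> + F t *v w + E *v \<delta>p)))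
                   - \<eta> \<bullet> ((Qi ** Q' ** Qi) *v \<eta>)
        in norm \<delta>p \<le> \<gamma> t * norm \<delta>q \<and> lyap_fun Q t \<eta> \<ge> (norm w)\<^sup>2
           \<longrightarrow> Vdot \<le> - \<alpha> * lyap_fun Q t \<eta>)"

definition ellipsoid :: "(real \<Rightarrow> real ^ 'x ^ 'x) \<Rightarrow> (real \<Rightarrow> real) \<Rightarrow> real \<Rightarrow> (real ^ 'x) set" where
  "ellipsoid Q r t = {\<eta>. \<eta> \<bullet> (matrix_inv (Q t) *v \<eta>) \<le> r t}"

definition invariant_for ::
    "real \<Rightarrow> real \<Rightarrow> ((real \<Rightarrow> 'a) \<Rightarrow> bool) \<Rightarrow> (real \<Rightarrow> 'a set) \<Rightarrow> bool" where
  "invariant_for t0 tf sol S \<longleftrightarrow>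
     (\<forall>\<eta>. sol \<eta> \<and> \<eta> t0 \<in> S t0 \<longrightarrow> (\<forall>t\<in>{t0..tf}. \<eta> t \<in> S t))"

end

theory Submission
  imports Defs
begin

text \<open>
  Write \<open>V(t, \<eta>) = \<eta> \<bullet> Q(t)\<^sup>-\<^sup>1 \<eta>\<close>. The Lyapunov condition is pointwise linear algebra: the block matrix
  inequality, evaluated at a suitable test vector, says that
  \<open>Vdot + \<alpha> V + \<lambda> (V - |w|\<^sup>2) + (\<gamma>\<^sup>2 |\<delta>q|\<^sup>2 - |\<delta>p|\<^sup>2)/\<nu> \<le> 0\<close>, and the two constraints
  \<open>V \<ge> |w|\<^sup>2\<close> and \<open>|\<delta>p| \<le> \<gamma> |\<delta>q|\<close> make the last two summands nonnegative
  (\<open>lmi_imp_lyapunov_decay\<close>).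

  For the assertions on solutions, disturbances satisfy \<open>|w| \<le> 1\<close>, so \<open>V\<close> decays at rate \<open>\<alpha>\<close> as long as
  \<open>V \<ge> 1\<close>: a solution either stays outside the unit ellipsoid and decays exponentially from its
  initial value, or it enters the unit ellipsoid and cannot leave it again
  (\<open>exp_decay_above_level_one\<close>). This is the attractivity bound, and both invariance claims follow
  from it, because the prescribed radii dominate that bound.

  The analytic difficulty is that solutions satisfy the differential equation only almost everywhere.
  What makes the decay argument valid is absolute continuity: an absolutely continuous function whose
  derivative is nonpositive almost everywhere is nonincreasing
  (\<open>abs_continuous_on_nonpos_derivative_imp_le\<close>). It applies to \<open>exp (\<alpha> t) V(t, \<eta>(t))\<close>
  because absolute continuity passes to products and to the inverse of \<open>Q\<close>.
\<close>

section \<open>Quadratic forms of block matrices\<close>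

definition vjoin :: "real ^ 'a \<Rightarrow> real ^ 'b \<Rightarrow> real ^ ('a + 'b)"  (infixr "\<oplus>\<^sub>v" 65) where
  "x \<oplus>\<^sub>v y = (\<chi> i. case i of Inl a \<Rightarrow> x $ a | Inr b \<Rightarrow> y $ b)"

lemma sum_UNIV_sum_type:
  fixes g :: "'a::finite + 'b::finite \<Rightarrow> 'c::comm_monoid_add"
  shows "sum g UNIV = (\<Sum>a\<in>UNIV. g (Inl a)) + (\<Sum>b\<in>UNIV. g (Inr b))"
  by (subst UNIV_Plus_UNIV [symmetric], subst sum.Plus) (simp_all add: o_def)

lemma hblock_mult_vjoin: "(P ||| R) *v (x \<oplus>\<^sub>v y) = P *v x + R *v y"
  by (simp add: vec_eq_iff matrix_vector_mult_def hblock_def vjoin_def sum_UNIV_sum_type)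

lemma vblock_mult: "(P /// R) *v z = (P *v z) \<oplus>\<^sub>v (R *v z)"
  by (simp add: vec_eq_iff matrix_vector_mult_def vblock_def vjoin_def split: sum.split)

lemma inner_vjoin: "(x \<oplus>\<^sub>v y) \<bullet> (x' \<oplus>\<^sub>v y') = x \<bullet> x' + y \<bullet> y'"
  by (simp add: inner_vec_def vjoin_def sum_UNIV_sum_type)

lemma inner_transpose_mult: "x \<bullet> (transpose P *v y) = y \<bullet> (P *v x)" for P :: "real ^ 'n ^ 'm"
  by (metis dot_lmul_matrix inner_commute transpose_matrix_vector)

lemma scaleR_mat_1_mult: "(c *\<^sub>R mat 1) *v x = c *\<^sub>R x" for x :: "real ^ 'n"
  by (simp add: scaleR_matrix_vector_assoc [symmetric])

lemma uminus_matrix_mult: "(- P) *v x = - (P *v x)" for P :: "real ^ 'n ^ 'm"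
  by (simp add: vec_eq_iff matrix_vector_mult_def sum_negf)

text \<open>The off-diagonal blocks come in transposed pairs, so each of them contributes a doubled
  scalar; the two terms in \<open>s\<close> combine because \<open>N\<close> and \<open>G\<close> share the last block row. The
  diagonal entry \<open>c\<close> stays general, since its value matters only when \<open>s\<close> is chosen.\<close>

lemma quadratic_form_lmi:
  fixes M :: "real ^ 'x ^ 'x" and E :: "real ^ 'p ^ 'x" and F :: "real ^ 'w ^ 'x"
    and N :: "real ^ 'x ^ 'q" and G :: "real ^ 'w ^ 'q"
  shows "(y \<oplus>\<^sub>v p \<oplus>\<^sub>v w \<oplus>\<^sub>v s) \<bullet>
     (((M                 ||| b *\<^sub>R E           ||| F               ||| transpose N) ///
       (b *\<^sub>R transpose E  ||| - (b *\<^sub>R mat 1)   ||| 0                 ||| 0) ///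
       (transpose F        ||| 0                   ||| - (l *\<^sub>R mat 1)  ||| transpose G) ///
       (N                      ||| 0                   ||| G                 ||| - (c *\<^sub>R mat 1)))
      *v (y \<oplus>\<^sub>v p \<oplus>\<^sub>v w \<oplus>\<^sub>v s))
   = y \<bullet> (M *v y) + 2 * b * (y \<bullet> (E *v p)) + 2 * (y \<bullet> (F *v w)) + 2 * (s \<bullet> (N *v y + G *v w))
     - b * (norm p)\<^sup>2 - l * (norm w)\<^sup>2 - c * (norm s)\<^sup>2"
  by (simp add: vblock_mult hblock_mult_vjoin inner_vjoin inner_transpose_mult scaleR_mat_1_mult
      uminus_matrix_mult inner_add_right inner_diff_right right_diff_distrib scaleR_matrix_vector_assoc [symmetric]
      power2_norm_eq_inner del: transpose_matrix_vector)

section \<open>Inverses of positive definite matrices\<close>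

lemma matrix_inv_inverse:
  assumes "invertible A"
  shows "A ** matrix_inv A = mat 1" "matrix_inv A ** A = mat 1"
proof -
  have "\<exists>A'. A ** A' = mat 1 \<and> A' ** A = mat 1"
    using assms by (simp add: invertible_def)
  from someI_ex [OF this] show "A ** matrix_inv A = mat 1" "matrix_inv A ** A = mat 1"
    by (auto simp: matrix_inv_def)
qed

lemma pos_def_matrix_invertible:
  assumes "pos_def_matrix X" shows "invertible X"
proof -
  have "v = 0" if "X *v v = 0" for v
    using assms that unfolding pos_def_matrix_def by force
  then show ?thesis
    using invertible_left_inverse matrix_left_invertible_ker by blast
qed

text \<open>The inverse inherits self-adjointness from \<open>X\<close>. This identity lets the factor
  \<open>matrix_inv X\<close> be moved to the vector \<open>x\<close>, and thereby turns expressions in \<open>x\<close>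
  into expressions in the test vector \<open>y = matrix_inv X *v x\<close>.\<close>

lemma pos_def_matrix_inv_inner:
  assumes "pos_def_matrix X"
  shows "x \<bullet> (matrix_inv X *v z) = (matrix_inv X *v x) \<bullet> z"
proof -
  note inv = matrix_inv_inverse [OF pos_def_matrix_invertible [OF assms]]
  have "x \<bullet> (matrix_inv X *v z) = (X *v (matrix_inv X *v x)) \<bullet> (matrix_inv X *v z)"
    by (simp add: matrix_vector_mul_assoc inv)
  also have "\<dots> = (matrix_inv X *v x) \<bullet> (X *v (matrix_inv X *v z))"
    using assms by (metis pos_def_matrix_def inner_transpose_mult inner_commute)
  finally show ?thesis
    by (simp add: matrix_vector_mul_assoc inv)
qed

section \<open>The matrix inequality implies the Lyapunov condition\<close>

text \<open>Evaluate the matrix inequality at \<open>(Qi \<eta>, \<delta>p/\<nu>, w, (\<gamma>\<^sup>2/\<nu>) \<delta>q)\<close>. The first component is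
  the congruence by \<open>Q\<close>, which turns \<open>Y\<close> into \<open>K\<close>; the last one maximises the concave quadratic
  in the fourth slot, i.e. it performs the Schur complement. The outcome is
  \<open>Vdot + \<alpha> V + l (V - |w|\<^sup>2) + (\<gamma>\<^sup>2 |\<delta>q|\<^sup>2 - |\<delta>p|\<^sup>2)/\<nu> \<le> 0\<close>, and the hypotheses on \<open>\<delta>p\<close> and \<open>w\<close> make
  the last two summands nonnegative: \<open>l\<close> and \<open>1/\<nu>\<close> act as S-procedure multipliers.\<close>

lemma lmi_imp_lyapunov_decay:
  fixes Q Q' A :: "real ^ 'x ^ 'x" and B :: "real ^ 'u ^ 'x" and F :: "real ^ 'w ^ 'x"
    and E :: "real ^ 'p ^ 'x" and C :: "real ^ 'x ^ 'q" and D :: "real ^ 'u ^ 'q" and G :: "real ^ 'w ^ 'q"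
    and Y :: "real ^ 'x ^ 'u" and \<alpha> \<nu> \<gamma> l :: real
  defines "M \<equiv> Q ** transpose A + transpose Y ** transpose B + A ** Q + B ** Y
              + \<alpha> *\<^sub>R Q + l *\<^sub>R Q"
    and "N \<equiv> C ** Q + D ** Y" and "K \<equiv> Y ** matrix_inv Q" and "Qi \<equiv> matrix_inv Q"
  assumes pd: "pos_def_matrix Q" and "0 < \<gamma>" "0 < \<nu>" "0 < l"
    and lmi: "neg_semidef_matrix
          ((M - Q'                 ||| \<nu> *\<^sub>R E           ||| F               ||| transpose N) ///
           (\<nu> *\<^sub>R transpose E  ||| - (\<nu> *\<^sub>R mat 1)   ||| 0                 ||| 0) ///
           (transpose F        ||| 0                   ||| - (l *\<^sub>R mat 1)  ||| transpose G) ///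
           (N                      ||| 0                   ||| G            ||| - ((\<nu> * (1 / \<gamma>\<^sup>2)) *\<^sub>R mat 1)))"
    and p: "norm \<delta>p \<le> \<gamma> * norm ((C + D ** K) *v \<eta> + G *v w)"
    and w: "(norm w)\<^sup>2 \<le> \<eta> \<bullet> (Qi *v \<eta>)"
  shows "2 * (\<eta> \<bullet> (Qi *v ((A + B ** K) *v \<eta> + F *v w + E *v \<delta>p))) - \<eta> \<bullet> ((Qi ** Q' ** Qi) *v \<eta>)
     \<le> - \<alpha> * (\<eta> \<bullet> (Qi *v \<eta>))"
proof -
  define y where "y = Qi *v \<eta>"
  define q where "q = (C + D ** K) *v \<eta> + G *v w"
  \<comment> \<open>The maximiser of \<open>2 (s \<bullet> q) - (\<nu>/\<gamma>\<^sup>2) |s|\<^sup>2\<close>.\<close>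
  define s where "s = (\<gamma>\<^sup>2 / \<nu>) *\<^sub>R q"
  note inv = matrix_inv_inverse [OF pos_def_matrix_invertible [OF pd], folded Qi_def]
  note sym = pos_def_matrix_inv_inner [OF pd, folded Qi_def]
  have \<eta>: "\<eta> = Q *v y" by (simp add: y_def matrix_vector_mul_assoc inv)
  have K\<eta>: "K *v \<eta> = Y *v y"
    by (simp add: K_def y_def Qi_def matrix_vector_mul_assoc)
  have q: "q = N *v y + G *v w"
    by (simp add: q_def N_def matrix_vector_mult_add_rdistrib matrix_vector_mul_assoc [symmetric] K\<eta>)
       (simp add: \<eta>)
  have QT: "transpose Q = Q" using pd by (simp add: pos_def_matrix_def)
  have V: "y \<bullet> \<eta> = \<eta> \<bullet> (Qi *v \<eta>)"
    by (simp add: y_def inner_commute)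
  have T1: "y \<bullet> (Q *v (transpose A *v y)) = y \<bullet> (A *v \<eta>)"
    by (metis QT \<eta> inner_transpose_mult inner_commute)
  have T2: "y \<bullet> (transpose Y *v (transpose B *v y)) = y \<bullet> (B *v (K *v \<eta>))"
    by (metis K\<eta> inner_transpose_mult inner_commute)
  have "y \<bullet> (M *v y) = 2 * (y \<bullet> ((A + B ** K) *v \<eta>)) + (\<alpha> + l) * (\<eta> \<bullet> (Qi *v \<eta>))"
    unfolding M_def
    by (simp add: matrix_vector_mult_add_rdistrib matrix_vector_mul_assoc [symmetric] inner_add_right
      T1 T2 V scaleR_matrix_vector_assoc [symmetric] K\<eta> \<eta> [symmetric] ring_distribs
      del: transpose_matrix_vector)
  moreover have "y \<bullet> ((M - Q') *v y) + 2 * \<nu> * (y \<bullet> (E *v ((1/\<nu>) *\<^sub>R \<delta>p))) + 2 * (y \<bullet> (F *v w))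
     + 2 * (s \<bullet> (N *v y + G *v w))
     - \<nu> * (norm ((1/\<nu>) *\<^sub>R \<delta>p))\<^sup>2 - l * (norm w)\<^sup>2 - (\<nu> * (1 / \<gamma>\<^sup>2)) * (norm s)\<^sup>2 \<le> 0"
    using lmi unfolding neg_semidef_matrix_def quadratic_form_lmi [symmetric] by blast
  moreover have "\<nu> * (y \<bullet> (E *v ((1/\<nu>) *\<^sub>R \<delta>p))) = y \<bullet> (E *v \<delta>p)"
    using \<open>0 < \<nu>\<close> by (simp add: matrix_vector_mult_scaleR)
  moreover have "\<nu> * (norm ((1/\<nu>) *\<^sub>R \<delta>p))\<^sup>2 = (norm \<delta>p)\<^sup>2 / \<nu>"
    using \<open>0 < \<nu>\<close> by (simp add: power2_eq_square)
  moreover have "2 * (s \<bullet> (N *v y + G *v w)) - (\<nu> * (1 / \<gamma>\<^sup>2)) * (norm s)\<^sup>2 = \<gamma>\<^sup>2 * (norm q)\<^sup>2 / \<nu>"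
    using \<open>0 < \<nu>\<close> \<open>0 < \<gamma>\<close> unfolding q [symmetric] s_def
    by (simp add: power2_norm_eq_inner power_mult_distrib field_simps)
       (simp add: power2_eq_square algebra_simps)
  moreover have "(norm \<delta>p)\<^sup>2 / \<nu> \<le> \<gamma>\<^sup>2 * (norm q)\<^sup>2 / \<nu>"
    using power_mono [OF p norm_ge_zero, of 2] \<open>0 < \<nu>\<close>
    by (simp add: q_def power_mult_distrib divide_right_mono)
  moreover have "l * (norm w)\<^sup>2 \<le> l * (\<eta> \<bullet> (Qi *v \<eta>))"
    using w \<open>0 < l\<close> by simp
  moreover have "\<eta> \<bullet> ((Qi ** Q' ** Qi) *v \<eta>) = y \<bullet> (Q' *v y)"
    by (simp add: matrix_vector_mul_assoc [symmetric] sym y_def)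
  moreover have "\<eta> \<bullet> (Qi *v ((A + B ** K) *v \<eta> + F *v w + E *v \<delta>p))
      = y \<bullet> ((A + B ** K) *v \<eta>) + y \<bullet> (F *v w) + y \<bullet> (E *v \<delta>p)"
    by (simp only: sym y_def [symmetric] inner_add_right)
  ultimately show ?thesis
    by (simp add: matrix_vector_mult_diff_rdistrib inner_diff_right ring_distribs)
qed

lemma abs_continuous_on_subset:
  "abs_continuous_on f S \<Longrightarrow> T \<subseteq> S \<Longrightarrow> abs_continuous_on f T"
  unfolding abs_continuous_on_def by (meson order_trans)

section \<open>Absolutely continuous functions on an interval\<close>

lemma abs_continuous_onE:
  assumes "abs_continuous_on f S" "e > 0"
  obtains d where "d > 0"
    "\<And>D. D division_of \<Union>D \<Longrightarrow> \<Union>D \<subseteq> S \<Longrightarrow> (\<Sum>k\<in>D. Sup k - Inf k) < d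
      \<Longrightarrow> (\<Sum>k\<in>D. norm (f (Sup k) - f (Inf k))) < e"
proof -
  have "\<exists>d>0. \<forall>D. D division_of \<Union>D \<and> \<Union>D \<subseteq> S \<and> (\<Sum>k\<in>D. Sup k - Inf k) < d
      \<longrightarrow> (\<Sum>k\<in>D. norm (f (Sup k) - f (Inf k))) < e"
    using assms by (simp only: abs_continuous_on_def)
  then show thesis
    by (elim exE conjE) (rule that, assumption, simp)
qed

lemma division_real_interval:
  fixes D :: "real set set"
  assumes "D division_of S" "k \<in> D"
  shows "k = {Inf k..Sup k}" "Inf k \<le> Sup k" "Inf k \<in> S" "Sup k \<in> S"
proof -
  obtain a b where k: "k = {a..b}" "k \<noteq> {}" "k \<subseteq> S"
    using division_ofD(2,3,4) [OF assms(1,2)] by (metis box_real(2))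
  then show "k = {Inf k..Sup k}" "Inf k \<le> Sup k" "Inf k \<in> S" "Sup k \<in> S"
    by auto
qed

text \<open>Absolute continuity only sees increments, so it passes from \<open>f\<close> and \<open>g\<close> to every function
  whose increments they control. Lipschitz functions, products and matrix inverses are all
  instances of this principle.\<close>

lemma abs_continuous_on_dominated:
  fixes f :: "real \<Rightarrow> 'a::real_normed_vector" and g :: "real \<Rightarrow> 'b::real_normed_vector"
    and h :: "real \<Rightarrow> 'c::real_normed_vector"
  assumes f: "abs_continuous_on f S" and g: "abs_continuous_on g S"
    and le: "\<And>s t. s \<in> S \<Longrightarrow> t \<in> S \<Longrightarrow> norm (h s - h t) \<le> L * (norm (f s - f t) + norm (g s - g t))"
  shows "abs_continuous_on h S"
  unfolding abs_continuous_on_def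
proof (intro allI impI)
  fix e :: real assume "e > 0"
  define L' where "L' = 2 * (\<bar>L\<bar> + 1)"
  have L': "L' > 0" "e / L' > 0" using \<open>e > 0\<close> by (auto simp: L'_def)
  obtain d1 where d1: "d1 > 0" "\<And>D. D division_of \<Union>D \<Longrightarrow> \<Union>D \<subseteq> S \<Longrightarrow> (\<Sum>k\<in>D. Sup k - Inf k) < d1
      \<Longrightarrow> (\<Sum>k\<in>D. norm (f (Sup k) - f (Inf k))) < e / L'"
    using abs_continuous_onE [OF f L'(2)] by blast
  obtain d2 where d2: "d2 > 0" "\<And>D. D division_of \<Union>D \<Longrightarrow> \<Union>D \<subseteq> S \<Longrightarrow> (\<Sum>k\<in>D. Sup k - Inf k) < d2
      \<Longrightarrow> (\<Sum>k\<in>D. norm (g (Sup k) - g (Inf k))) < e / L'"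
    using abs_continuous_onE [OF g L'(2)] by blast
  show "\<exists>d>0. \<forall>D. D division_of \<Union>D \<and> \<Union>D \<subseteq> S \<and> (\<Sum>k\<in>D. Sup k - Inf k) < d
        \<longrightarrow> (\<Sum>k\<in>D. norm (h (Sup k) - h (Inf k))) < e"
  proof (intro exI conjI allI impI)
    show "min d1 d2 > 0" using d1 d2 by simp
    fix D assume D: "D division_of \<Union>D \<and> \<Union>D \<subseteq> S \<and> (\<Sum>k\<in>D. Sup k - Inf k) < min d1 d2"
    have "norm (h (Sup k) - h (Inf k))
        \<le> (L' / 2) * (norm (f (Sup k) - f (Inf k)) + norm (g (Sup k) - g (Inf k)))" if "k \<in> D" for k
    proof -
      have "Sup k \<in> S" "Inf k \<in> S" using division_real_interval [of D "\<Union>D" k] D that by blast+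
      from le [OF this] show ?thesis
        by (rule order_trans) (rule mult_right_mono, simp_all add: L'_def)
    qed
    then have "(\<Sum>k\<in>D. norm (h (Sup k) - h (Inf k)))
       \<le> (\<Sum>k\<in>D. (L' / 2) * (norm (f (Sup k) - f (Inf k)) + norm (g (Sup k) - g (Inf k))))"
      by (rule sum_mono)
    also have "\<dots> = (L' / 2) * ((\<Sum>k\<in>D. norm (f (Sup k) - f (Inf k))) + (\<Sum>k\<in>D. norm (g (Sup k) - g (Inf k))))"
      by (simp only: sum_distrib_left [symmetric] sum.distrib [symmetric])
    also have "\<dots> < (L' / 2) * (e / L' + e / L')"
      using d1(2) [of D] d2(2) [of D] D L' by (intro mult_strict_left_mono add_strict_mono) auto
    also have "\<dots> = e" using L' by (simp add: field_simps)
    finally show "(\<Sum>k\<in>D. norm (h (Sup k) - h (Inf k))) < e" .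
  qed
qed

lemma abs_continuous_on_lipschitz:
  fixes h :: "real \<Rightarrow> 'a::real_normed_vector"
  assumes "\<And>s t. s \<in> S \<Longrightarrow> t \<in> S \<Longrightarrow> norm (h s - h t) \<le> L * \<bar>s - t\<bar>"
  shows "abs_continuous_on h S"
proof -
  have id: "abs_continuous_on (\<lambda>t::real. t) S"
    unfolding abs_continuous_on_def
  proof (intro allI impI, rule exI, intro conjI allI impI)
    fix e :: real and D :: "real set set"
    assume "e > 0" and D: "D division_of \<Union>D \<and> \<Union>D \<subseteq> S \<and> (\<Sum>k\<in>D. Sup k - Inf k) < e"
    have "(\<Sum>k\<in>D. norm (Sup k - Inf k)) = (\<Sum>k\<in>D. Sup k - Inf k)"
      using D division_real_interval(2) by (intro sum.cong) auto
    then show "(\<Sum>k\<in>D. norm (Sup k - Inf k)) < e" using D by simp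
  qed
  show ?thesis
  proof (rule abs_continuous_on_dominated [OF id id, where L = "L / 2"])
    show "norm (h s - h t) \<le> L / 2 * (norm (s - t) + norm (s - t))" if "s \<in> S" "t \<in> S" for s t
      using assms [OF that] by simp
  qed
qed

lemma abs_continuous_on_imp_continuous_on:
  assumes f: "abs_continuous_on f {a..b}"
  shows "continuous_on {a..b} f"
  unfolding continuous_on_iff
proof (intro ballI allI impI)
  fix t e :: real assume t: "t \<in> {a..b}" and "e > 0"
  obtain d where d: "d > 0" "\<And>D. D division_of \<Union>D \<Longrightarrow> \<Union>D \<subseteq> {a..b} \<Longrightarrow> (\<Sum>k\<in>D. Sup k - Inf k) < d
      \<Longrightarrow> (\<Sum>k\<in>D. norm (f (Sup k) - f (Inf k))) < e"
    using abs_continuous_onE [OF f \<open>e > 0\<close>] by blast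
  have *: "norm (f v - f u) < e" if "u \<le> v" "u \<in> {a..b}" "v \<in> {a..b}" "v - u < d" for u v
    using d(2) [of "{{u..v}}"] that division_of_self [of u v] by (auto simp: box_real)
  show "\<exists>d>0. \<forall>s\<in>{a..b}. dist s t < d \<longrightarrow> dist (f s) (f t) < e"
  proof (intro exI conjI ballI impI)
    fix s assume "s \<in> {a..b}" "dist s t < d"
    then show "dist (f s) (f t) < e"
      using *[of s t] *[of t s] t
      by (cases "s \<le> t") (auto simp: dist_norm norm_minus_commute)
  qed (fact d(1))
qed

lemma (in bounded_bilinear) abs_continuous_on_prod:
  assumes f: "abs_continuous_on f {a..b}" and g: "abs_continuous_on g {a..b}"
  shows "abs_continuous_on (\<lambda>t. prod (f t) (g t)) {a..b}"
proof -
  have "bounded (f ` {a..b})" "bounded (g ` {a..b})"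
    using f g by (auto intro!: compact_imp_bounded compact_continuous_image abs_continuous_on_imp_continuous_on)
  then obtain R1 R2 where R: "\<And>t. t \<in> {a..b} \<Longrightarrow> norm (f t) \<le> R1" "\<And>t. t \<in> {a..b} \<Longrightarrow> norm (g t) \<le> R2"
    unfolding bounded_iff by (metis imageI)
  define R where "R = max 0 (max R1 R2)"
  obtain K where K: "K > 0" "\<And>x y. norm (prod x y) \<le> norm x * norm y * K"
    using pos_bounded by blast
  show ?thesis
  proof (rule abs_continuous_on_dominated [OF f g, where L = "R * K"])
    fix s t assume st: "s \<in> {a..b}" "t \<in> {a..b}"
    then have nf: "norm (f s) \<le> R" and ng: "norm (g t) \<le> R" and "R \<ge> 0"
      using R(1)[of s] R(2)[of t] by (auto simp: R_def)
    have "prod (f s) (g s) - prod (f t) (g t) = prod (f s) (g s - g t) + prod (f s - f t) (g t)"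
      by (simp add: diff_left diff_right)
    then have "norm (prod (f s) (g s) - prod (f t) (g t))
        \<le> norm (f s) * norm (g s - g t) * K + norm (f s - f t) * norm (g t) * K"
      using norm_triangle_ineq K(2) by (smt (verit))
    also have "\<dots> \<le> R * norm (g s - g t) * K + norm (f s - f t) * R * K"
      using nf ng \<open>R \<ge> 0\<close> K(1) by (intro add_mono mult_right_mono mult_left_mono) auto
    finally show "norm (prod (f s) (g s) - prod (f t) (g t)) \<le> R * K * (norm (f s - f t) + norm (g s - g t))"
      by (simp add: algebra_simps)
  qed
qed

text \<open>On an interval around its tag \<open>t\<close> the increment splits at \<open>t\<close> into two increments, each
  within \<open>e\<close> times its length of the linear approximation; a nonpositive slope can then be dropped.\<close>

lemma straddle_nonpos_derivative:
  fixes g :: "real \<Rightarrow> real"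
  assumes "(g has_vector_derivative d) (at t within S)" "d \<le> 0" "e > 0"
  obtains r where "r > 0"
    "\<And>u v. u \<in> S \<Longrightarrow> v \<in> S \<Longrightarrow> u \<le> t \<Longrightarrow> t \<le> v \<Longrightarrow> {u..v} \<subseteq> ball t r \<Longrightarrow> g v - g u \<le> e * (v - u)"
proof -
  obtain r where r: "r > 0"
    "\<And>y. y \<in> S \<Longrightarrow> \<bar>y - t\<bar> < r \<Longrightarrow> \<bar>g y - g t - (y - t) * d\<bar> \<le> e * \<bar>y - t\<bar>"
    using assms(1,3) unfolding has_vector_derivative_def has_derivative_within_alt
    by (metis real_norm_def real_scaleR_def)
  show thesis
  proof
    fix u v assume *: "u \<in> S" "v \<in> S" "u \<le> t" "t \<le> v" "{u..v} \<subseteq> ball t r"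
    then have "u \<in> ball t r" "v \<in> ball t r"
      by (meson atLeastAtMost_iff order_refl order_trans subsetD)+
    then have "\<bar>g v - g t - (v - t) * d\<bar> \<le> e * (v - t)" "\<bar>g u - g t - (u - t) * d\<bar> \<le> e * (t - u)"
      using r(2) [of v] r(2) [of u] * by (auto simp: dist_real_def)
    then have "g v - g u \<le> e * (v - u) + (v - u) * d"
      by (simp add: algebra_simps abs_le_iff)
    also have "\<dots> \<le> e * (v - u)"
      using * \<open>d \<le> 0\<close> by (simp add: mult_nonneg_nonpos)
    finally show "g v - g u \<le> e * (v - u)" .
  qed (fact r(1))
qed

section \<open>Monotonicity from the sign of the derivative almost everywhere\<close>

text \<open>A null set lies in an open set of measure below the \<open>\<delta>\<close> of absolute continuity, and
  the total length of a division inside that set is at most its measure. Hence exceptional points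
  of measure zero contribute arbitrarily little variation.\<close>

lemma abs_continuous_on_division_small:
  assumes f: "abs_continuous_on f S" and N: "negligible N" and "e > 0"
  obtains U where "open U" "N \<subseteq> U"
    "\<And>D. D division_of \<Union>D \<Longrightarrow> \<Union>D \<subseteq> S \<inter> U \<Longrightarrow> (\<Sum>k\<in>D. norm (f (Sup k) - f (Inf k))) < e"
proof -
  obtain d where d: "d > 0" "\<And>D. D division_of \<Union>D \<Longrightarrow> \<Union>D \<subseteq> S \<Longrightarrow> (\<Sum>k\<in>D. Sup k - Inf k) < d
      \<Longrightarrow> (\<Sum>k\<in>D. norm (f (Sup k) - f (Inf k))) < e"
    using abs_continuous_onE [OF f \<open>e > 0\<close>] by blast
  obtain U where U: "open U" "N \<subseteq> U" "U - N \<in> lmeasurable" "emeasure lebesgue (U - N) < ennreal d"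
    using sets_lebesgue_outer_open [OF negligible_imp_sets [OF N] \<open>d > 0\<close>] .
  have Um: "U \<in> lmeasurable" and mU: "measure lebesgue U < d"
  proof -
    have "U = (U - N) \<union> N" using U by auto
    then show *: "U \<in> lmeasurable"
      using U(3) negligible_imp_measurable [OF N] by (metis fmeasurable.Un)
    have "measure lebesgue (U - N) < d"
      using U(3,4) d(1) by (simp add: emeasure_eq_measure2 ennreal_less_iff)
    then show "measure lebesgue U < d"
      using N * by (simp add: measure_Diff_null_set negligible_iff_null_sets fmeasurableD)
  qed
  show thesis
  proof
    fix D assume D: "D division_of \<Union>D" "\<Union>D \<subseteq> S \<inter> U"
    have "(\<Sum>k\<in>D. Sup k - Inf k) = (\<Sum>k\<in>D. measure lebesgue k)"
    proof (rule sum.cong)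
      fix k assume "k \<in> D"
      note k = division_real_interval(1,2) [OF D(1) this]
      have "measure lebesgue {Inf k..Sup k} = Sup k - Inf k" using k(2) by simp
      then show "Sup k - Inf k = measure lebesgue k" using k(1) by simp
    qed simp
    also have "\<dots> = measure lebesgue (\<Union>D)" by (rule content_division [OF D(1)])
    also have "\<dots> \<le> measure lebesgue U"
      using D Um by (intro measure_mono_fmeasurable) (auto intro: lmeasurable_division fmeasurableD)
    finally show "(\<Sum>k\<in>D. norm (f (Sup k) - f (Inf k))) < e"
      using d(2) [OF D(1)] D(2) mU by auto
  qed (use U in auto)
qed

text \<open>A Cousin argument, which avoids Lebesgue differentiation altogether. The gauge keeps intervals
  tagged in \<open>N\<close> inside an open set on which \<open>g\<close> varies by less than \<open>e\<close>, and keeps the other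
  intervals so short that \<open>g\<close> increases by at most \<open>e\<close> times their length. Summing the increments over
  a fine tagged division bounds \<open>g b - g a\<close> by \<open>e (b - a + 1)\<close> for every \<open>e > 0\<close>.\<close>

lemma abs_continuous_on_nonpos_derivative_imp_le:
  fixes g :: "real \<Rightarrow> real"
  assumes "a \<le> b" and ac: "abs_continuous_on g {a..b}" and N: "negligible N"
    and deriv: "\<And>t. t \<in> {a..b} - N \<Longrightarrow> \<exists>d\<le>0. (g has_vector_derivative d) (at t within {a..b})"
  shows "g b \<le> g a"
proof -
  have "g b - g a \<le> e * (b - a + 1)" if "e > 0" for e
  proof -
    obtain U where U: "open U" "N \<subseteq> U"
      and small: "\<And>D. D division_of \<Union>D \<Longrightarrow> \<Union>D \<subseteq> {a..b} \<inter> U \<Longrightarrow> (\<Sum>k\<in>D. norm (g (Sup k) - g (Inf k))) < e"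
      using abs_continuous_on_division_small [OF ac N \<open>e > 0\<close>] by metis
    have "\<exists>r>0. (t \<in> N \<longrightarrow> ball t r \<subseteq> U) \<and>
       (t \<in> {a..b} - N \<longrightarrow> (\<forall>u v. u \<in> {a..b} \<longrightarrow> v \<in> {a..b} \<longrightarrow> u \<le> t \<longrightarrow> t \<le> v \<longrightarrow> {u..v} \<subseteq> ball t r
          \<longrightarrow> g v - g u \<le> e * (v - u)))" for t
    proof (cases "t \<in> N")
      case True
      then show ?thesis using U by (meson DiffD2 openE subsetD)
    next
      case False
      show ?thesis
      proof (cases "t \<in> {a..b}")
        case True
        then obtain d where "(g has_vector_derivative d) (at t within {a..b})" "d \<le> 0"
          using deriv False by auto
        from straddle_nonpos_derivative [OF this \<open>e > 0\<close>] show ?thesis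
          using False by metis
      qed (use False zero_less_one in blast)
    qed
    then obtain r where r: "\<And>t. r t > 0" "\<And>t. t \<in> N \<Longrightarrow> ball t (r t) \<subseteq> U"
       "\<And>t u v. t \<in> {a..b} - N \<Longrightarrow> u \<in> {a..b} \<Longrightarrow> v \<in> {a..b} \<Longrightarrow> u \<le> t \<Longrightarrow> t \<le> v \<Longrightarrow> {u..v} \<subseteq> ball t (r t)
          \<Longrightarrow> g v - g u \<le> e * (v - u)"
      by metis
    obtain p where p: "p tagged_division_of {a..b}" "(\<lambda>t. ball t (r t)) fine p"
      using fine_division_exists_real [OF gauge_ball_dependent] r(1) by metis
    note pD = tagged_division_ofD [OF p(1)]
    \<comment> \<open>Passing from tagged intervals to the set of intervals requires the value \<open>0\<close> at \<open>{}\<close>,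
      whose infimum and supremum are unspecified reals.\<close>
    define inc where "inc = (\<lambda>k. if k = {} then 0 else g (Sup k) - g (Inf k))"
    have inc: "inc k = g (Sup k) - g (Inf k)" if "(t,k) \<in> p" for t k
      using pD(2) [OF that] by (auto simp: inc_def)
    define p1 where "p1 = {x \<in> p. fst x \<in> N}"
    define p2 where "p2 = p - p1"
    have p12: "p = p1 \<union> p2" "p1 \<inter> p2 = {}" "p1 \<subseteq> p" "p2 \<subseteq> p" "finite p1" "finite p2"
      using pD(1) by (auto simp: p1_def p2_def)
    have "g b - g a = (\<Sum>(t,k)\<in>p. inc k)"
      unfolding additive_tagged_division_1 [OF \<open>a \<le> b\<close> p(1), of g, symmetric]
      by (intro sum.cong) (auto simp: inc)
    also have "\<dots> = (\<Sum>(t,k)\<in>p1. inc k) + (\<Sum>(t,k)\<in>p2. inc k)"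
      using p12 by (simp add: sum.union_disjoint)
    also have "(\<Sum>(t,k)\<in>p1. inc k) \<le> (\<Sum>(t,k)\<in>p1. norm (inc k))"
      by (intro sum_mono) auto
    also have "\<dots> < e"
    proof -
      have td: "p1 tagged_division_of \<Union>(snd ` p1)"
        using tagged_partial_division_of_Union_self tagged_partial_division_subset p12(3) p(1)
          tagged_division_of_def by metis
      have "(\<Sum>(t,k)\<in>p1. norm (inc k)) = (\<Sum>k\<in>snd ` p1. norm (inc k))"
        by (rule sum.over_tagged_division_lemma [OF td]) (auto simp: inc_def box_eq_empty)
      moreover have "(\<Sum>k\<in>snd ` p1. norm (inc k)) = (\<Sum>k\<in>snd ` p1. norm (g (Sup k) - g (Inf k)))"
        using p12(3) inc by (intro sum.cong) auto
      moreover have "\<Union>(snd ` p1) \<subseteq> {a..b} \<inter> U"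
      proof -
        have "k \<subseteq> {a..b} \<inter> U" if "(t,k) \<in> p1" for t k
        proof -
          have *: "(t,k) \<in> p" "t \<in> N" using that by (auto simp: p1_def)
          show ?thesis using pD(3) [OF *(1)] fineD [OF p(2) *(1)] r(2) [OF *(2)] by blast
        qed
        then show ?thesis by (intro UN_least) (metis prod.collapse)
      qed
      ultimately show ?thesis
        using small [OF division_of_tagged_division [OF td]] by simp
    qed
    also have "(\<Sum>(t,k)\<in>p2. inc k) \<le> (\<Sum>(t,k)\<in>p2. e * (Sup k - Inf k))"
    proof (intro sum_mono, clarify)
      fix t k assume "(t,k) \<in> p2"
      then have *: "(t,k) \<in> p" "t \<notin> N" by (auto simp: p1_def p2_def)
      obtain u v where k: "k = {u..v}" using pD(4) [OF *(1)] by (auto simp: box_real)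
      have t: "t \<in> k" and sub: "k \<subseteq> {a..b}" "k \<subseteq> ball t (r t)"
        using pD(2,3) [OF *(1)] fineD [OF p(2) *(1)] by auto
      then have uv: "u \<le> t" "t \<le> v" "u \<in> {a..b}" "v \<in> {a..b}" "t \<in> {a..b}" by (auto simp: k)
      have "g v - g u \<le> e * (v - u)"
        using r(3) [of t u v] uv *(2) sub k by auto
      then show "inc k \<le> e * (Sup k - Inf k)" using uv inc [OF *(1)] by (simp add: k)
    qed
    also have "\<dots> \<le> (\<Sum>(t,k)\<in>p. e * (Sup k - Inf k))"
    proof (rule sum_mono2)
      show "finite p" "p2 \<subseteq> p" using pD p12 by auto
      fix x assume "x \<in> p - p2"
      then have x: "(fst x, snd x) \<in> p" by auto
      obtain u v where "snd x = {u..v}" using pD(4) [OF x] by (auto simp: box_real)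
      moreover from this have "u \<le> v" using pD(2) [OF x] by simp
      ultimately show "0 \<le> (case x of (t,k) \<Rightarrow> e * (Sup k - Inf k))"
        using \<open>e > 0\<close> by (simp add: case_prod_unfold)
    qed
    also have "\<dots> = e * (b - a)"
      using additive_tagged_division_1 [OF \<open>a \<le> b\<close> p(1), of "\<lambda>x. e * x"]
      by (simp add: right_diff_distrib)
    finally show ?thesis by (simp add: algebra_simps)
  qed
  then have "(g b - g a) / (b - a + 1) \<le> e" if "e > 0" for e
    using that \<open>a \<le> b\<close> by (simp add: divide_le_eq mult.commute)
  then have "(g b - g a) / (b - a + 1) \<le> 0"
    by (meson dense_ge)
  then show ?thesis using \<open>a \<le> b\<close> by (simp add: divide_le_0_iff)
qed

section \<open>The inverse of a matrix-valued curve\<close>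

lemma bounded_bilinear_matrix_vector_mult:
  "bounded_bilinear (\<lambda>(P :: real ^ 'n ^ 'm) v. P *v v)"
  unfolding bilinear_conv_bounded_bilinear [symmetric] bilinear_def
  by (auto intro!: linearI simp: matrix_vector_mult_add_rdistrib matrix_vector_right_distrib
      matrix_vector_mult_scaleR scaleR_matrix_vector_assoc)

lemma bounded_bilinear_matrix_matrix_mult:
  "bounded_bilinear (\<lambda>(P :: real ^ 'n ^ 'm) (R :: real ^ 'k ^ 'n). P ** R)"
  unfolding bilinear_conv_bounded_bilinear [symmetric] bilinear_def
  by (auto intro!: linearI simp: vec_eq_iff matrix_matrix_mult_def sum.distrib
      sum_distrib_left distrib_left distrib_right mult_ac)

lemma continuous_on_det:
  fixes Q :: "'a::topological_space \<Rightarrow> real ^ 'n ^ 'n"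
  assumes "\<And>i j. continuous_on S (\<lambda>t. Q t $ i $ j)"
  shows "continuous_on S (\<lambda>t. det (Q t))"
  unfolding det_def by (intro continuous_on_sum continuous_on_mult continuous_on_const continuous_on_prod assms)

text \<open>By Cramer's rule the entries of the inverse are quotients of determinants, and these are
  polynomials in the entries.\<close>

lemma continuous_on_matrix_inv:
  fixes Q :: "'a::topological_space \<Rightarrow> real ^ 'n ^ 'n"
  assumes Q: "continuous_on S Q" and inv: "\<And>t. t \<in> S \<Longrightarrow> invertible (Q t)"
  shows "continuous_on S (\<lambda>t. matrix_inv (Q t))"
proof -
  have entry: "matrix_inv (Q t) $ k $ j
      = det (\<chi> i l. if l = k then axis j 1 $ i else Q t $ i $ l) / det (Q t)" if "t \<in> S" for t k j
  proof -
    have "det (Q t) \<noteq> 0" using inv [OF that] invertible_det_nz by blast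
    moreover have "Q t *v (matrix_inv (Q t) *v axis j 1) = axis j 1"
      by (simp add: matrix_vector_mul_assoc matrix_inv_inverse [OF inv [OF that]])
    ultimately have "matrix_inv (Q t) *v axis j 1
      = (\<chi> k. det (\<chi> i l. if l = k then axis j 1 $ i else Q t $ i $ l) / det (Q t))"
      using cramer by blast
    then have "(matrix_inv (Q t) *v axis j 1) $ k
      = det (\<chi> i l. if l = k then axis j 1 $ i else Q t $ i $ l) / det (Q t)"
      by simp
    then show ?thesis
      by (simp add: matrix_vector_mult_basis column_def)
  qed
  have ent: "continuous_on S (\<lambda>t. Q t $ i $ l)" for i l
    using Q by (intro continuous_intros)
  have "continuous_on S (\<lambda>t. det (\<chi> i l. if l = k then axis j 1 $ i else Q t $ i $ l) / det (Q t))" for k j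
  proof (intro continuous_on_divide continuous_on_det)
    show "continuous_on S (\<lambda>t. (\<chi> i l. if l = k then axis j 1 $ i else Q t $ i $ l) $ i $ l)" for i l
      using ent by (cases "l = k") auto
    show "\<forall>t\<in>S. det (Q t) \<noteq> 0" using inv invertible_det_nz by blast
  qed (rule ent)
  then have "continuous_on S (\<lambda>t. matrix_inv (Q t) $ k $ j)" for k j
    using entry by (simp cong: continuous_on_cong)
  then have "continuous_on S (\<lambda>t. \<chi> k j. matrix_inv (Q t) $ k $ j)"
    by (intro continuous_on_vec_lambda)
  then show ?thesis by simp
qed

text \<open>The resolvent identity: increments of the inverse are increments of the matrix between two
  inverses. Both the derivative and the absolute continuity of the inverse come from it.\<close>

lemma matrix_inv_diff:
  fixes P R :: "real ^ 'n ^ 'n"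
  assumes "invertible P" "invertible R"
  shows "matrix_inv P - matrix_inv R = - (matrix_inv P ** (P - R) ** matrix_inv R)"
proof -
  interpret bounded_bilinear "\<lambda>(P :: real ^ 'n ^ 'n) (R :: real ^ 'n ^ 'n). P ** R"
    by (rule bounded_bilinear_matrix_matrix_mult)
  have "matrix_inv P ** (P - R) ** matrix_inv R
      = matrix_inv P ** P ** matrix_inv R - matrix_inv P ** (R ** matrix_inv R)"
    by (simp add: diff_left diff_right matrix_mul_assoc)
  then show ?thesis by (simp add: matrix_inv_inverse assms)
qed

text \<open>By the resolvent identity the difference quotient of the inverse is
  \<open>- P(s) ((Q(s) - Q(t))/(s - t)) P(t)\<close> with \<open>P = Q\<^sup>-\<^sup>1\<close>, so continuity of \<open>P\<close> gives the limit.
  The derivative is taken within \<open>S\<close> to cover the end points of an interval.\<close>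

lemma has_vector_derivative_matrix_inv:
  fixes Q :: "real \<Rightarrow> real ^ 'n ^ 'n"
  assumes Q: "(Q has_vector_derivative Q') (at t within S)"
    and cont: "continuous_on S (\<lambda>t. matrix_inv (Q t))"
    and inv: "\<And>t. t \<in> S \<Longrightarrow> invertible (Q t)" and t: "t \<in> S"
  shows "((\<lambda>t. matrix_inv (Q t)) has_vector_derivative
     - (matrix_inv (Q t) ** Q' ** matrix_inv (Q t))) (at t within S)"
proof -
  interpret mm: bounded_bilinear "\<lambda>(P :: real ^ 'n ^ 'n) (R :: real ^ 'n ^ 'n). P ** R"
    by (rule bounded_bilinear_matrix_matrix_mult)
  let ?P = "\<lambda>t. matrix_inv (Q t)"
  have lim: "((\<lambda>s. (1 / norm (s - t)) *\<^sub>R (Q s - (Q t + (s - t) *\<^sub>R Q'))) \<longlongrightarrow> 0) (at t within S)"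
    using Q by (simp add: has_vector_derivative_def has_derivative_within)
  have P: "(?P \<longlongrightarrow> ?P t) (at t within S)"
    using cont t by (simp add: continuous_on_def)
  have "((\<lambda>s. - (?P s ** ((1 / norm (s - t)) *\<^sub>R (Q s - (Q t + (s - t) *\<^sub>R Q'))) ** ?P t)) \<longlongrightarrow> 0) (at t within S)"
    using tendsto_minus [OF mm.tendsto [OF mm.tendsto [OF P lim] tendsto_const [of "?P t"]]]
    by (simp add: mm.zero_left mm.zero_right)
  moreover have "((\<lambda>s. ((s - t) / norm (s - t)) *\<^sub>R ((?P s - ?P t) ** Q' ** ?P t)) \<longlongrightarrow> 0) (at t within S)"
  proof (rule Lim_null_comparison)
    show "\<forall>\<^sub>F s in at t within S. norm (((s - t) / norm (s - t)) *\<^sub>R ((?P s - ?P t) ** Q' ** ?P t))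
        \<le> norm ((?P s - ?P t) ** Q' ** ?P t)"
      by (rule always_eventually) (auto simp: divide_simps)
    have "((\<lambda>s. (?P s - ?P t) ** Q' ** ?P t) \<longlongrightarrow> (?P t - ?P t) ** Q' ** ?P t) (at t within S)"
      by (intro mm.tendsto tendsto_diff P tendsto_const)
    then show "((\<lambda>s. norm ((?P s - ?P t) ** Q' ** ?P t)) \<longlongrightarrow> 0) (at t within S)"
      by (simp add: mm.zero_left tendsto_norm_zero)
  qed
  ultimately have lim': "((\<lambda>s. - (?P s ** ((1 / norm (s - t)) *\<^sub>R (Q s - (Q t + (s - t) *\<^sub>R Q'))) ** ?P t)
      - ((s - t) / norm (s - t)) *\<^sub>R ((?P s - ?P t) ** Q' ** ?P t)) \<longlongrightarrow> 0 - 0) (at t within S)"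
    by (rule tendsto_diff)
  have eq: "- (?P s ** ((1 / norm (s - t)) *\<^sub>R (Q s - (Q t + (s - t) *\<^sub>R Q'))) ** ?P t)
      - ((s - t) / norm (s - t)) *\<^sub>R ((?P s - ?P t) ** Q' ** ?P t)
      = (1 / norm (s - t)) *\<^sub>R (?P s - (?P t + (s - t) *\<^sub>R (- (?P t ** Q' ** ?P t))))" if "s \<in> S" for s
  proof -
    have expand: "- (P ** (c *\<^sub>R (X - h *\<^sub>R Q')) ** R) - (h * c) *\<^sub>R ((P - R) ** Q' ** R)
        = c *\<^sub>R (- (P ** X ** R) + h *\<^sub>R (R ** Q' ** R))" for P R X :: "real ^ 'n ^ 'n" and c h
      by (simp add: mm.diff_left mm.diff_right mm.scaleR_left mm.scaleR_right
          scaleR_add_right scaleR_diff_right mult.commute)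
    have "- (?P s ** (Q s - Q t) ** ?P t) = ?P s - ?P t"
      using matrix_inv_diff [OF inv [OF that] inv [OF t]] by simp
    then show ?thesis
      using expand [of "?P s" "1 / norm (s - t)" "Q s - Q t" "s - t" "?P t"]
      by (simp add: diff_diff_eq)
  qed
  have "((\<lambda>s. (1 / norm (s - t)) *\<^sub>R (?P s - (?P t + (s - t) *\<^sub>R (- (?P t ** Q' ** ?P t))))) \<longlongrightarrow> 0 - 0)
     (at t within S)"
    by (rule Lim_transform_eventually [OF lim']) (use eq in \<open>simp add: eventually_at_filter\<close>)
  then show ?thesis
    unfolding has_vector_derivative_def has_derivative_within
    by (intro conjI bounded_linear_scaleR_left) simp
qed

lemma cont_differentiable_on_imp_lipschitz:
  fixes f :: "real \<Rightarrow> 'b::real_normed_vector"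
  assumes "cont_differentiable_on f {a..b}"
  obtains L where "\<And>s t. s \<in> {a..b} \<Longrightarrow> t \<in> {a..b} \<Longrightarrow> norm (f s - f t) \<le> L * \<bar>s - t\<bar>"
proof -
  obtain f' where f': "\<And>z. z \<in> {a..b} \<Longrightarrow> (f has_derivative blinfun_apply (f' z)) (at z within {a..b})"
    and cont: "continuous_on {a..b} f'"
    using assms unfolding cont_differentiable_on_def by blast
  have "bounded (f' ` {a..b})"
    using cont by (intro compact_imp_bounded compact_continuous_image) auto
  then obtain L where L: "\<And>z. z \<in> {a..b} \<Longrightarrow> norm (f' z) \<le> L"
    unfolding bounded_iff by (metis imageI)
  show thesis
  proof
    show "norm (f s - f t) \<le> L * \<bar>s - t\<bar>" if "s \<in> {a..b}" "t \<in> {a..b}" for s t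
      using differentiable_bound [OF _ f' _ that, of L] L by (simp add: norm_blinfun.rep_eq)
  qed
qed

lemma abs_continuous_on_matrix_inv:
  fixes Q :: "real \<Rightarrow> real ^ 'n ^ 'n"
  assumes Q: "abs_continuous_on Q {a..b}" and inv: "\<And>t. t \<in> {a..b} \<Longrightarrow> invertible (Q t)"
  shows "abs_continuous_on (\<lambda>t. matrix_inv (Q t)) {a..b}"
proof -
  interpret mm: bounded_bilinear "\<lambda>(P :: real ^ 'n ^ 'n) (R :: real ^ 'n ^ 'n). P ** R"
    by (rule bounded_bilinear_matrix_matrix_mult)
  have "continuous_on {a..b} (\<lambda>t. matrix_inv (Q t))"
    by (intro continuous_on_matrix_inv abs_continuous_on_imp_continuous_on Q inv)
  then have "bounded ((\<lambda>t. matrix_inv (Q t)) ` {a..b})"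
    by (intro compact_imp_bounded compact_continuous_image) auto
  then obtain R where R: "\<And>t. t \<in> {a..b} \<Longrightarrow> norm (matrix_inv (Q t)) \<le> R"
    unfolding bounded_iff by (metis imageI)
  obtain K where K: "K > 0" "\<And>(P :: real ^ 'n ^ 'n) (R :: real ^ 'n ^ 'n). norm (P ** R) \<le> norm P * norm R * K"
    using mm.pos_bounded by blast
  show ?thesis
  proof (rule abs_continuous_on_dominated [OF Q Q, where L = "R * R * K * K"])
    fix s t assume st: "s \<in> {a..b}" "t \<in> {a..b}"
    have "0 \<le> R" by (rule order_trans [OF norm_ge_zero R [OF st(1)]])
    have "norm (matrix_inv (Q s) - matrix_inv (Q t))
        = norm (matrix_inv (Q s) ** (Q s - Q t) ** matrix_inv (Q t))"
      by (subst matrix_inv_diff [OF inv [OF st(1)] inv [OF st(2)]]) (rule norm_minus_cancel)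
    also have "\<dots> \<le> norm (matrix_inv (Q s) ** (Q s - Q t)) * norm (matrix_inv (Q t)) * K"
      by (rule K)
    also have "\<dots> \<le> (R * norm (Q s - Q t) * K) * R * K"
    proof -
      have "norm (matrix_inv (Q s) ** (Q s - Q t)) \<le> R * norm (Q s - Q t) * K"
        by (rule order_trans [OF K(2)]) (intro mult_right_mono R st(1) norm_ge_zero less_imp_le [OF K(1)])
      then show ?thesis
        using K(1) R [OF st(2)] \<open>0 \<le> R\<close> by (intro mult_mono [OF mult_mono]) auto
    qed
    also have "\<dots> \<le> R * R * K * K * (norm (Q s - Q t) + norm (Q s - Q t))"
      using \<open>0 \<le> R\<close> K(1) by (simp add: algebra_simps)
    finally show "norm (matrix_inv (Q s) - matrix_inv (Q t))
        \<le> R * R * K * K * (norm (Q s - Q t) + norm (Q s - Q t))" .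
  qed
qed

section \<open>Exponential decay outside the unit level set\<close>

text \<open>Decay is only known while \<open>V\<close> is at least \<open>1\<close>. Going back from \<open>t\<close> to the last time \<open>s\<close> at which
  \<open>V s \<le> 1\<close> (or to \<open>a\<close>, if there is none), \<open>exp (\<alpha> s) V s\<close> has nonpositive derivative almost
  everywhere after \<open>s\<close> and hence decreases. Starting from \<open>s\<close> this gives \<open>V t \<le> 1\<close>, starting from
  \<open>a\<close> it gives the exponential bound.\<close>

lemma exp_decay_above_level_one:
  fixes V :: "real \<Rightarrow> real"
  assumes ac: "abs_continuous_on V {a..b}" and "0 \<le> \<alpha>" and N: "negligible N"
    and deriv: "\<And>t. t \<in> {a..b} - N \<Longrightarrow> 1 \<le> V t \<Longrightarrow>
       \<exists>d. (V has_vector_derivative d) (at t within {a..b}) \<and> d \<le> - \<alpha> * V t"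
    and t: "t \<in> {a..b}"
  shows "V t \<le> max (exp (- \<alpha> * (t - a)) * V a) 1"
proof -
  define g where "g = (\<lambda>s. exp (\<alpha> * s) * V s)"
  have "abs_continuous_on (\<lambda>s. exp (\<alpha> * s)) {a..b}"
  proof (rule abs_continuous_on_lipschitz)
    fix s t :: real assume st: "s \<in> {a..b}" "t \<in> {a..b}"
    have "norm (exp (\<alpha> * s) - exp (\<alpha> * t)) \<le> (\<alpha> * exp (\<alpha> * b)) * norm (s - t)"
    proof (rule field_differentiable_bound [of "{a..b}"])
      show "((\<lambda>s. exp (\<alpha> * s)) has_field_derivative \<alpha> * exp (\<alpha> * z)) (at z within {a..b})" for z
        by (auto intro!: derivative_eq_intros)
      show "norm (\<alpha> * exp (\<alpha> * z)) \<le> \<alpha> * exp (\<alpha> * b)" if "z \<in> {a..b}" for z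
        using that \<open>0 \<le> \<alpha>\<close> by (auto simp: abs_mult intro!: mult_left_mono)
    qed (use st in auto)
    then show "norm (exp (\<alpha> * s) - exp (\<alpha> * t)) \<le> (\<alpha> * exp (\<alpha> * b)) * \<bar>s - t\<bar>"
      by simp
  qed
  then have acg: "abs_continuous_on g {a..b}"
    unfolding g_def by (rule bounded_bilinear.abs_continuous_on_prod [OF bounded_bilinear_mult _ ac])
  have decay: "V t \<le> exp (- \<alpha> * (t - s)) * V s"
    if s: "s \<in> {a..t}" and above: "\<And>r. r \<in> {s<..t} \<Longrightarrow> 1 \<le> V r" for s
  proof -
    have sub: "{s..t} \<subseteq> {a..b}" using s t by auto
    have "g t \<le> g s"
    proof (rule abs_continuous_on_nonpos_derivative_imp_le [where g = g and a = s and b = t and N = "insert s N"])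
      show "abs_continuous_on g {s..t}" by (rule abs_continuous_on_subset [OF acg sub])
      \<comment> \<open>At \<open>s\<close> itself \<open>V\<close> may be below \<open>1\<close>, so \<open>s\<close> is counted among the exceptional points.\<close>
      show "negligible (insert s N)" using N by simp
      show "\<exists>d\<le>0. (g has_vector_derivative d) (at r within {s..t})" if "r \<in> {s..t} - insert s N" for r
      proof -
        have "r \<in> {a..b} - N" "1 \<le> V r" using that sub above [of r] by auto
        then obtain d where d: "(V has_vector_derivative d) (at r within {a..b})" "d \<le> - \<alpha> * V r"
          using deriv by blast
        have "((\<lambda>s. exp (\<alpha> * s)) has_vector_derivative \<alpha> * exp (\<alpha> * r)) (at r within {s..t})"
          unfolding has_real_derivative_iff_has_vector_derivative [symmetric]
          by (auto intro!: derivative_eq_intros)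
        from has_vector_derivative_mult [OF this has_vector_derivative_within_subset [OF d(1) sub]]
        have "(g has_vector_derivative exp (\<alpha> * r) * (d + \<alpha> * V r)) (at r within {s..t})"
          by (simp add: g_def algebra_simps)
        moreover have "exp (\<alpha> * r) * (d + \<alpha> * V r) \<le> 0"
          using d(2) by (simp add: mult_nonneg_nonpos)
        ultimately show ?thesis by blast
      qed
    qed (use s in auto)
    then have "exp (\<alpha> * t) * V t \<le> exp (\<alpha> * s) * V s" by (simp add: g_def)
    then have "V t \<le> exp (\<alpha> * s) * V s / exp (\<alpha> * t)"
      by (simp add: pos_le_divide_eq mult.commute)
    also have "\<dots> = exp (\<alpha> * s - \<alpha> * t) * V s" by (simp add: exp_diff)
    also have "\<alpha> * s - \<alpha> * t = - \<alpha> * (t - s)" by (simp add: algebra_simps)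
    finally show ?thesis .
  qed
  define S where "S = {a..t} \<inter> V -` {..1}"
  show ?thesis
  proof (cases "S = {}")
    case True
    then have "1 < V r" if "r \<in> {a..t}" for r
      using that by (force simp: S_def not_le)
    then have "V t \<le> exp (- \<alpha> * (t - a)) * V a"
      using t by (intro decay less_imp_le) auto
    then show ?thesis by simp
  next
    case False
    have "continuous_on {a..t} V"
      using abs_continuous_on_imp_continuous_on [OF ac] t by (auto intro: continuous_on_subset)
    then have "closed S"
      unfolding S_def by (intro continuous_closed_preimage closed_atLeastAtMost closed_atMost)
    moreover have bdd: "bdd_above S" by (auto simp: S_def)
    ultimately have SS: "Sup S \<in> S" using False by (intro closed_contains_Sup)
    have "V t \<le> exp (- \<alpha> * (t - Sup S)) * V (Sup S)"
    proof (rule decay)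
      show "Sup S \<in> {a..t}" using SS by (simp add: S_def)
      fix r assume r: "r \<in> {Sup S<..t}"
      then have "r \<notin> S" using cSup_upper [OF _ bdd] by force
      then show "1 \<le> V r" using r SS by (auto simp: S_def)
    qed
    also have "\<dots> \<le> exp (- \<alpha> * (t - Sup S)) * 1"
      using SS by (intro mult_left_mono) (auto simp: S_def)
    also have "\<dots> \<le> 1" using SS \<open>0 \<le> \<alpha>\<close> by (auto simp: S_def)
    finally show ?thesis by simp
  qed
qed

section \<open>The Lyapunov function along solutions\<close>

lemma abs_continuous_on_lyap_fun:
  fixes Q :: "real \<Rightarrow> real ^ 'n ^ 'n"
  assumes Q: "cont_differentiable_on Q {a..b}" and inv: "\<And>t. t \<in> {a..b} \<Longrightarrow> invertible (Q t)"
    and \<eta>: "abs_continuous_on \<eta> {a..b}"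
  shows "abs_continuous_on (\<lambda>t. lyap_fun Q t (\<eta> t)) {a..b}"
proof -
  obtain L where "\<And>s t. s \<in> {a..b} \<Longrightarrow> t \<in> {a..b} \<Longrightarrow> norm (Q s - Q t) \<le> L * \<bar>s - t\<bar>"
    using cont_differentiable_on_imp_lipschitz [OF Q] by blast
  then have "abs_continuous_on Q {a..b}"
    by (rule abs_continuous_on_lipschitz)
  then show ?thesis
    unfolding lyap_fun_def
    by (intro bounded_bilinear.abs_continuous_on_prod [OF bounded_bilinear_inner]
        bounded_bilinear.abs_continuous_on_prod [OF bounded_bilinear_matrix_vector_mult]
        abs_continuous_on_matrix_inv \<eta> inv)
qed

text \<open>The product rule with the derivative of the inverse; symmetry of the inverse merges the two terms
  in \<open>\<eta>'\<close>. The right-hand side has the form of \<open>Vdot\<close> in \<^const>\<open>lyapunov_condition\<close>.\<close>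

lemma lyap_fun_has_vector_derivative:
  fixes Q :: "real \<Rightarrow> real ^ 'n ^ 'n"
  assumes Q: "(Q has_vector_derivative Q') (at t within S)" and cont: "continuous_on S Q"
    and pd: "\<And>t. t \<in> S \<Longrightarrow> pos_def_matrix (Q t)" and t: "t \<in> S"
    and \<eta>: "(\<eta> has_vector_derivative \<eta>') (at t within S)"
  shows "((\<lambda>t. lyap_fun Q t (\<eta> t)) has_vector_derivative
     2 * (\<eta> t \<bullet> (matrix_inv (Q t) *v \<eta>'))
     - \<eta> t \<bullet> ((matrix_inv (Q t) ** Q' ** matrix_inv (Q t)) *v \<eta> t)) (at t within S)"
proof -
  have inv: "\<And>t. t \<in> S \<Longrightarrow> invertible (Q t)"
    using pd pos_def_matrix_invertible by blast
  note dQi = has_vector_derivative_matrix_inv [OF Q continuous_on_matrix_inv [OF cont inv] inv t]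
  note d = bounded_bilinear.has_vector_derivative [OF bounded_bilinear_inner \<eta>
      bounded_bilinear.has_vector_derivative [OF bounded_bilinear_matrix_vector_mult dQi \<eta>]]
  have "\<eta>' \<bullet> (matrix_inv (Q t) *v \<eta> t) = \<eta> t \<bullet> (matrix_inv (Q t) *v \<eta>')"
    using pos_def_matrix_inv_inner [OF pd [OF t], of "\<eta> t" \<eta>'] by (simp add: inner_commute)
  then show ?thesis
    using d unfolding lyap_fun_def
    by (simp add: inner_add_right inner_diff_right uminus_matrix_mult)
qed

lemma AE_lebesgue_on_imp_negligible:
  assumes "AE t in lebesgue_on S. P t" and "S \<in> sets lebesgue"
  obtains N where "negligible N" "\<And>t. t \<in> S - N \<Longrightarrow> P t"
proof -
  have "AE t in lebesgue. t \<in> S \<longrightarrow> P t"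
    using assms by (simp add: AE_restrict_space_iff)
  then obtain N where "N \<in> null_sets lebesgue" "{t. \<not> (t \<in> S \<longrightarrow> P t)} \<subseteq> N"
    unfolding eventually_ae_filter by auto
  then show thesis
    by (intro that [of N]) (auto simp: negligible_iff_null_sets)
qed

text \<open>Since \<open>|w| \<le> 1\<close>, the premise \<open>V \<ge> |w|\<^sup>2\<close> of the Lyapunov condition is met whenever \<open>V \<ge> 1\<close>, so \<open>V\<close>
  decays at rate \<open>\<alpha>\<close> at almost every time at which the solution is outside the unit ellipsoid or on its boundary.\<close>

lemma lyapunov_condition_imp_decay:
  fixes Q :: "real \<Rightarrow> real ^ 'x ^ 'x"
  assumes lyap: "lyapunov_condition t0 tf A B F E C D G \<gamma> Q K \<alpha>" and "0 \<le> \<alpha>"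
    and Q: "cont_differentiable_on Q {t0..tf}"
    and pd: "\<And>t. t \<in> {t0..tf} \<Longrightarrow> pos_def_matrix (Q t)"
    and sol: "closed_loop_solution t0 tf A B F E C D G \<gamma> K \<eta>" and t: "t \<in> {t0..tf}"
  shows "lyap_fun Q t (\<eta> t) \<le> max (exp (- \<alpha> * (t - t0)) * lyap_fun Q t0 (\<eta> t0)) 1"
proof -
  let ?Q' = "\<lambda>t. vector_derivative Q (at t within {t0..tf})"
  obtain w \<delta>p where ac: "abs_continuous_on \<eta> {t0..tf}"
    and sup: "(SUP t\<in>{t0..tf}. ereal (norm (w t))) \<le> 1"
    and \<delta>p: "\<And>t. t \<in> {t0..tf} \<Longrightarrow> norm (\<delta>p t) \<le> \<gamma> t * norm (C *v \<eta> t + D *v (K t *v \<eta> t) + G *v w t)"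
    and ode: "AE t in lebesgue_on {t0..tf}.
      (\<eta> has_vector_derivative (A t + B t ** K t) *v \<eta> t + F t *v w t + E *v \<delta>p t) (at t within {t0..tf})"
    using sol unfolding closed_loop_solution_def Let_def by blast
  obtain N where N: "negligible N" and deriv: "\<And>t. t \<in> {t0..tf} - N \<Longrightarrow>
      (\<eta> has_vector_derivative (A t + B t ** K t) *v \<eta> t + F t *v w t + E *v \<delta>p t) (at t within {t0..tf})"
    using AE_lebesgue_on_imp_negligible [OF ode] by auto
  have w: "norm (w t) \<le> 1" if "t \<in> {t0..tf}" for t
    using sup that by (simp add: SUP_le_iff)
  have Q': "(Q has_vector_derivative ?Q' t) (at t within {t0..tf})" if "t \<in> {t0..tf}" for t
  proof -
    have "Q differentiable (at t within {t0..tf})"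
      using Q that unfolding cont_differentiable_on_def differentiable_def by blast
    then show ?thesis by (simp add: vector_derivative_works)
  qed
  have inv: "\<And>t. t \<in> {t0..tf} \<Longrightarrow> invertible (Q t)"
    using pd pos_def_matrix_invertible by blast
  have contQ: "continuous_on {t0..tf} Q"
    using Q' by (meson continuous_on_eq_continuous_within has_vector_derivative_continuous)
  show ?thesis
  proof (rule exp_decay_above_level_one [OF abs_continuous_on_lyap_fun [OF Q inv ac] \<open>0 \<le> \<alpha>\<close> N _ t])
    fix r assume r: "r \<in> {t0..tf} - N" and above: "1 \<le> lyap_fun Q r (\<eta> r)"
    then have r': "r \<in> {t0..tf}" by simp
    have "norm (\<delta>p r) \<le> \<gamma> r * norm ((C + D ** K r) *v \<eta> r + G *v w r)"
      using \<delta>p [OF r'] by (simp add: matrix_vector_mult_add_rdistrib matrix_vector_mul_assoc)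
    moreover have "(norm (w r))\<^sup>2 \<le> lyap_fun Q r (\<eta> r)"
      using power_le_one [OF norm_ge_zero w [OF r'], of 2] above by linarith
    ultimately have "2 * (\<eta> r \<bullet> (matrix_inv (Q r) *v ((A r + B r ** K r) *v \<eta> r + F r *v w r + E *v \<delta>p r)))
        - \<eta> r \<bullet> ((matrix_inv (Q r) ** ?Q' r ** matrix_inv (Q r)) *v \<eta> r) \<le> - \<alpha> * lyap_fun Q r (\<eta> r)"
      using lyap r' unfolding lyapunov_condition_def Let_def by blast
    with lyap_fun_has_vector_derivative [OF Q' [OF r'] contQ pd r' deriv [OF r]]
    show "\<exists>d. ((\<lambda>t. lyap_fun Q t (\<eta> t)) has_vector_derivative d) (at r within {t0..tf})
        \<and> d \<le> - \<alpha> * lyap_fun Q r (\<eta> r)"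
      by blast
  qed
qed

section \<open>Invariance and attractivity of the ellipsoid\<close>

theorem theorem1:
  fixes t0 tf :: real
    and f :: "real \<times> (real ^ 'x) \<times> (real ^ 'u) \<times> (real ^ 'w) \<Rightarrow> real ^ 'x"
    and xbar :: "real \<Rightarrow> real ^ 'x" and ubar :: "real \<Rightarrow> real ^ 'u"
    and A :: "real \<Rightarrow> real ^ 'x ^ 'x" and B :: "real \<Rightarrow> real ^ 'u ^ 'x" and F :: "real \<Rightarrow> real ^ 'w ^ 'x"
    and E :: "real ^ 'p ^ 'x" and C :: "real ^ 'x ^ 'q" and D :: "real ^ 'u ^ 'q" and G :: "real ^ 'w ^ 'q"
    and \<gamma> \<nu> :: "real \<Rightarrow> real" and lam_w \<alpha> :: real
    and Q :: "real \<Rightarrow> real ^ 'x ^ 'x" and Y K :: "real \<Rightarrow> real ^ 'x ^ 'u"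
  assumes "0 \<le> t0" and "t0 < tf"
    and "cont_differentiable_on f ({0..} \<times> UNIV)"
    and "ode_trajectory f t0 tf xbar ubar (\<lambda>t. 0)"
    and "\<forall>t\<in>{t0..tf}. A t = jacobian (\<lambda>x. f (t, x, ubar t, 0)) (at (xbar t))"
    and "\<forall>t\<in>{t0..tf}. B t = jacobian (\<lambda>u. f (t, xbar t, u, 0)) (at (ubar t))"
    and "\<forall>t\<in>{t0..tf}. F t = jacobian (\<lambda>w. f (t, xbar t, ubar t, w)) (at 0)"
    and "\<forall>t\<in>{t0..tf}. 0 < \<gamma> t"
    and "cont_differentiable_on Q {t0..tf}"
    and "\<forall>t\<in>{t0..tf}. pos_def_matrix (Q t)"
    and "\<forall>t\<in>{t0..tf}. 0 < \<nu> t"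
    and "0 < lam_w" and "0 < \<alpha>"
    and "\<forall>t\<in>{t0..tf}.
      let Q' = vector_derivative Q (at t within {t0..tf});
          M = Q t ** transpose (A t) + transpose (Y t) ** transpose (B t) + A t ** Q t + B t ** Y t
              + \<alpha> *\<^sub>R Q t + lam_w *\<^sub>R Q t;
          N = C ** Q t + D ** Y t
      in neg_semidef_matrix
          ((M - Q'                 ||| \<nu> t *\<^sub>R E           ||| F t               ||| transpose N) ///
           (\<nu> t *\<^sub>R transpose E  ||| - (\<nu> t *\<^sub>R mat 1)   ||| 0                 ||| 0) ///
           (transpose (F t)        ||| 0                   ||| - (lam_w *\<^sub>R mat 1)  ||| transpose G) ///
           (N                      ||| 0                   ||| G                 ||| - ((\<nu> t * (1 / (\<gamma> t)\<^sup>2)) *\<^sub>R mat 1)))"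
    and "\<forall>t\<in>{t0..tf}. K t = Y t ** matrix_inv (Q t)"
  shows "lyapunov_condition t0 tf A B F E C D G \<gamma> Q K \<alpha> \<and>
    invariant_for t0 tf (closed_loop_solution t0 tf A B F E C D G \<gamma> K) (ellipsoid Q (\<lambda>t. 1)) \<and>
    (\<forall>\<eta>. closed_loop_solution t0 tf A B F E C D G \<gamma> K \<eta> \<longrightarrow>
       (\<forall>t\<in>{t0..tf}. lyap_fun Q t (\<eta> t) \<le> max (exp (- \<alpha> * (t - t0)) * lyap_fun Q t0 (\<eta> t0)) 1)) \<and>
    (\<forall>c :: real \<Rightarrow> real.
       continuous_on {t0..tf} c \<and> c ` {t0..tf} \<subseteq> {0<..1} \<and>
       (\<forall>t\<in>{t0..tf}. 1 / c t \<ge> max 1 (exp (- \<alpha> * (t - t0)) * (1 / c t0))) \<longrightarrow>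
       invariant_for t0 tf (closed_loop_solution t0 tf A B F E C D G \<gamma> K) (ellipsoid Q (\<lambda>t. 1 / c t)))"
proof -
  have lyap: "lyapunov_condition t0 tf A B F E C D G \<gamma> Q K \<alpha>"
    unfolding lyapunov_condition_def Let_def
  proof (intro ballI allI impI, elim conjE)
    fix t \<eta> w and \<delta>p :: "real ^ 'p"
    assume t: "t \<in> {t0..tf}"
      and p: "norm \<delta>p \<le> \<gamma> t * norm ((C + D ** K t) *v \<eta> + G *v w)"
      and w: "(norm w)\<^sup>2 \<le> lyap_fun Q t \<eta>"
    have K: "K t = Y t ** matrix_inv (Q t)" using assms(15) t by blast
    show "2 * (\<eta> \<bullet> (matrix_inv (Q t) *v ((A t + B t ** K t) *v \<eta> + F t *v w + E *v \<delta>p)))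
        - \<eta> \<bullet> ((matrix_inv (Q t) ** vector_derivative Q (at t within {t0..tf}) ** matrix_inv (Q t)) *v \<eta>)
        \<le> - \<alpha> * lyap_fun Q t \<eta>"
      unfolding lyap_fun_def K
    proof (rule lmi_imp_lyapunov_decay [OF _ _ _ assms(12) bspec [OF assms(14) t, unfolded Let_def]])
      show "pos_def_matrix (Q t)" "0 < \<gamma> t" "0 < \<nu> t" using assms(8,10,11) t by blast+
      show "norm \<delta>p \<le> \<gamma> t * norm ((C + D ** (Y t ** matrix_inv (Q t))) *v \<eta> + G *v w)"
        using p by (simp only: K)
      show "(norm w)\<^sup>2 \<le> \<eta> \<bullet> (matrix_inv (Q t) *v \<eta>)" using w by (simp only: lyap_fun_def)
    qed
  qed
  have decay: "lyap_fun Q t (\<eta> t) \<le> max (exp (- \<alpha> * (t - t0)) * lyap_fun Q t0 (\<eta> t0)) 1"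
    if "closed_loop_solution t0 tf A B F E C D G \<gamma> K \<eta>" "t \<in> {t0..tf}" for \<eta> t
    using lyapunov_condition_imp_decay [OF lyap _ assms(9) _ that] assms(10,13) by simp
  \<comment> \<open>Both invariance claims: the attractivity bound stays below every radius \<open>r\<close> that dominates
    \<open>1\<close> and the decayed initial radius.\<close>
  have inv: "invariant_for t0 tf (closed_loop_solution t0 tf A B F E C D G \<gamma> K) (ellipsoid Q r)"
    if r: "\<forall>t\<in>{t0..tf}. max 1 (exp (- \<alpha> * (t - t0)) * r t0) \<le> r t" for r
    unfolding invariant_for_def ellipsoid_def mem_Collect_eq lyap_fun_def [symmetric]
  proof (intro allI impI ballI, elim conjE)
    fix \<eta> t assume sol: "closed_loop_solution t0 tf A B F E C D G \<gamma> K \<eta>"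
      and init: "lyap_fun Q t0 (\<eta> t0) \<le> r t0" and t: "t \<in> {t0..tf}"
    have "exp (- \<alpha> * (t - t0)) * lyap_fun Q t0 (\<eta> t0) \<le> exp (- \<alpha> * (t - t0)) * r t0"
      using init by (intro mult_left_mono) auto
    then have "max (exp (- \<alpha> * (t - t0)) * lyap_fun Q t0 (\<eta> t0)) 1 \<le> r t"
      using bspec [OF r t] unfolding max.bounded_iff by (blast intro: order_trans)
    then show "lyap_fun Q t (\<eta> t) \<le> r t"
      using decay [OF sol t] by (rule order_trans [rotated])
  qed
  show ?thesis
  proof (intro conjI allI impI ballI)
    show "invariant_for t0 tf (closed_loop_solution t0 tf A B F E C D G \<gamma> K) (ellipsoid Q (\<lambda>t. 1))"
      using \<open>0 < \<alpha>\<close> by (intro inv) auto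
    show "invariant_for t0 tf (closed_loop_solution t0 tf A B F E C D G \<gamma> K) (ellipsoid Q (\<lambda>t. 1 / c t))"
      if "continuous_on {t0..tf} c \<and> c ` {t0..tf} \<subseteq> {0<..1} \<and>
         (\<forall>t\<in>{t0..tf}. 1 / c t \<ge> max 1 (exp (- \<alpha> * (t - t0)) * (1 / c t0)))" for c
      using that by (intro inv) (elim conjE)
  qed (fact lyap, fact decay)
qed

end
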